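(* Let $f:\mathbb{N}\to\mathbb{C}$ be an arbitrary arithmetic function, let $P(x)$ be a polynomial with integer coefficients, and let $n\in\mathbb{N}$. Then \[ \sum_{\substack{a=1\\ (a,n)=1}}^{n} f\big((P(a),n)\big)=\varphi(n)\sum_{d\mid n}\frac{(\mu*f)(d)}{\varphi(d)}\,N_P(d), \] where $N_P(d)$ is the number of incongruent solutions $x \pmod d$ of the congruence $P(x)\equiv 0\pmod d$ such that $(x,d)=1$.
   Context: $(x,y)$ denotes the greatest common divisor (with $(0,n)=n$). $\varphi$ is Euler's totient function, $\mu$ is the Möbius function and $(\mu*f)(m)=\sum_{k\mid m}\mu(k)f(m/k)$ is the Dirichlet convolution. *)

theory Defs
  imports
    Complex_Main
    "HOL-Computational_Algebra.Computational_Algebra"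
    "HOL-Number_Theory.Number_Theory"
begin

definition moebius_mu :: "nat \<Rightarrow> 'a :: comm_ring_1" where
  "moebius_mu n = (if squarefree n then (-1) ^ card (prime_factors n) else 0)"

definition dirichlet_conv ::
  "(nat \<Rightarrow> 'a :: comm_semiring_1) \<Rightarrow> (nat \<Rightarrow> 'a) \<Rightarrow> nat \<Rightarrow> 'a" where
  "dirichlet_conv f g m = (\<Sum>k | k dvd m. f k * g (m div k))"

(* The residue classes mod d are represented by 0, ..., d - 1; for d = 1 the only class is
   that of 0, which is coprime to 1. *)
definition num_unit_roots_mod :: "int poly \<Rightarrow> nat \<Rightarrow> nat" where
  "num_unit_roots_mod P d =
     card {x \<in> {0..<int d}. [poly P x = 0] (mod int d) \<and> gcd x (int d) = 1}"

end

theory Submission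
  imports Defs
begin

text \<open>
  Moebius inversion gives \<open>f m = (\<Sum>d | d dvd m. (\<mu> * f) d)\<close>. Inserting this for
  \<open>m = (P(a), n)\<close> and exchanging the sums, it remains to count the units \<open>a\<close> modulo \<open>n\<close> with
  \<open>d dvd P(a)\<close>. Reduction modulo \<open>d\<close> is a surjective homomorphism from the units modulo \<open>n\<close>
  to those modulo \<open>d\<close>, so each of the \<open>N\<^sub>P(d)\<close> unit roots has \<open>\<phi>(n) / \<phi>(d)\<close> preimages.
\<close>

text \<open>Adjoining a new prime preserves squarefreeness and adds exactly one prime factor, so the
  sign flips; without squarefreeness both sides vanish.\<close>

lemma moebius_mu_prime_mult:
  assumes "prime p" "\<not> p dvd d"
  shows "moebius_mu (p * d) = - (moebius_mu d :: 'a :: comm_ring_1)"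
proof -
  have "coprime p d"
    using assms by (simp add: prime_imp_coprime)
  then have sq: "squarefree (p * d) \<longleftrightarrow> squarefree d"
    using assms by (auto simp: squarefree_mult_coprime squarefree_prime dest: squarefree_multD)
  have "d \<noteq> 0"
    using assms(2) by (metis dvd_0_right)
  then have "prime_factors (p * d) = insert p (prime_factors d)"
    using assms by (auto simp: prime_factors_product prime_prime_factors)
  moreover have "p \<notin> prime_factors d"
    using assms by auto
  ultimately show ?thesis
    by (simp add: moebius_mu_def sq)
qed

text \<open>For \<open>n > 1\<close>, fix a prime \<open>p\<close> dividing \<open>n\<close>. The
  squarefree divisors pair up as \<open>d\<close> and \<open>p * d\<close> with \<open>d\<close> not
  divisible by \<open>p\<close>, and the two terms of each pair cancel.\<close>

lemma sum_moebius_mu_divisors: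
  assumes "n > 0"
  shows "(\<Sum>d | d dvd n. moebius_mu d) = (if n = 1 then 1 else (0 :: 'a :: comm_ring_1))"
proof (cases "n = 1")
  case False
  then obtain p where p: "prime p" "p dvd n"
    using prime_factor_nat by blast
  define A where "A = {d. d dvd n \<and> squarefree d \<and> \<not> p dvd d}"
  have fin: "finite {d. d dvd n}"
    using assms by simp
  have "{d. d dvd n \<and> squarefree d} = A \<union> (*) p ` A" (is "?D = _")
  proof (intro equalityI subsetI)
    fix d assume d: "d \<in> ?D"
    show "d \<in> A \<union> (*) p ` A"
    proof (cases "p dvd d")
      case True
      then obtain e where e: "d = p * e" ..
      have "\<not> p dvd e"
      proof
        assume "p dvd e"
        then have "p\<^sup>2 dvd d"
          unfolding e power2_eq_square by (rule mult_dvd_mono[OF dvd_refl])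
        then show False
          using d p(1) by (auto dest: squarefreeD)
      qed
      then have "e \<in> A"
        using d e by (auto simp: A_def dest: squarefree_multD dvd_mult_right)
      then show ?thesis
        using e by blast
    qed (use d in \<open>auto simp: A_def\<close>)
  next
    fix d assume "d \<in> A \<union> (*) p ` A"
    then show "d \<in> ?D"
    proof
      assume "d \<in> (*) p ` A"
      then obtain e where e: "d = p * e" "e \<in> A"
        by blast
      have "coprime p e"
        using e p by (simp add: A_def prime_imp_coprime)
      then show ?thesis
        using e p by (auto simp: A_def squarefree_mult_coprime squarefree_prime divides_mult)
    qed (auto simp: A_def)
  qed
  moreover have "(\<Sum>d | d dvd n. moebius_mu d) = (\<Sum>d\<in>?D. moebius_mu d :: 'a)"
    by (intro sum.mono_neutral_right fin) (auto simp: moebius_mu_def)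
  moreover have "finite A"
    using fin by (rule rev_finite_subset) (auto simp: A_def)
  then have "(\<Sum>d\<in>A \<union> (*) p ` A. moebius_mu d :: 'a) =
             (\<Sum>d\<in>A. moebius_mu d) + (\<Sum>d\<in>(*) p ` A. moebius_mu d)"
    by (intro sum.union_disjoint) (auto simp: A_def)
  moreover have "(\<Sum>d\<in>(*) p ` A. moebius_mu d) = (\<Sum>d\<in>A. - moebius_mu d :: 'a)"
    using p by (subst sum.reindex) (auto simp: inj_on_def A_def moebius_mu_prime_mult)
  ultimately show ?thesis
    using False by (simp add: sum_negf)
qed (simp add: moebius_mu_def)

text \<open>Regrouping the double sum by \<open>e = d div k\<close> leaves the Moebius sum over the
  divisors of \<open>m div e\<close> as the coefficient of \<open>f e\<close>, which vanishes unless
  \<open>e = m\<close>.\<close>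

lemma moebius_inversion:
  fixes f :: "nat \<Rightarrow> 'a :: comm_ring_1"
  assumes "m > 0"
  shows "(\<Sum>d | d dvd m. dirichlet_conv moebius_mu f d) = f m"
proof -
  have fin: "finite {d. d dvd k}" if "k dvd m" for k
    using assms that dvd_pos_nat finite_divisors_nat by blast
  have "(\<Sum>d | d dvd m. dirichlet_conv moebius_mu f d) =
        (\<Sum>(d, k)\<in>Sigma {d. d dvd m} (\<lambda>d. {k. k dvd d}). moebius_mu k * f (d div k))"
    unfolding dirichlet_conv_def by (intro sum.Sigma ballI fin) auto
  also have "\<dots> = (\<Sum>(e, k)\<in>Sigma {e. e dvd m} (\<lambda>e. {k. k dvd m div e}). moebius_mu k * f e)"
    using assms
    by (intro sum.reindex_bij_witness[where i = "\<lambda>(e, k). (e * k, k)" and j = "\<lambda>(d, k). (d div k, k)"])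
       (auto elim!: dvdE)
  also have "\<dots> = (\<Sum>e | e dvd m. \<Sum>k | k dvd m div e. moebius_mu k * f e)"
    by (rule sum.Sigma [symmetric]) (use fin in \<open>auto intro: fin simp: div_dvd_iff_mult\<close>)
  also have "\<dots> = (\<Sum>e | e dvd m. if e = m then f e else 0)"
  proof (rule sum.cong)
    fix e assume "e \<in> {e. e dvd m}"
    then obtain k where k: "m = e * k"
      by auto
    have "(\<Sum>k | k dvd m div e. moebius_mu k * f e) = (\<Sum>k | k dvd m div e. moebius_mu k) * f e"
      by (simp add: sum_distrib_right)
    also have "\<dots> = (if e = m then f e else 0)"
      using assms k by (subst sum_moebius_mu_divisors) auto
    finally show "(\<Sum>k | k dvd m div e. moebius_mu k * f e) = (if e = m then f e else 0)" .
  qed simp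
  also have "\<dots> = f m"
    using fin[of m] by simp
  finally show ?thesis .
qed

text \<open>Representatives start at 0, unlike those in \<open>totatives\<close>, so that they are
  exactly the values of \<open>mod\<close>. The two sets differ only at \<open>n = 1\<close>, where
  the single class is 0 here and 1 there.\<close>

definition unit_residues :: "nat \<Rightarrow> nat set" where
  "unit_residues n = {a. a < n \<and> coprime a n}"

lemma finite_unit_residues [simp]: "finite (unit_residues n)"
  by (simp add: unit_residues_def)

lemma unit_residues_1 [simp]: "unit_residues (Suc 0) = {0}"
  by (auto simp: unit_residues_def)

lemma totatives_eq_unit_residues:
  assumes "n > 1"
  shows "totatives n = unit_residues n"
proof -
  have "a \<noteq> n" "a \<noteq> 0" if "coprime a n" for a
    using that assms by (auto intro!: Nat.gr0I)
  then show ?thesis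
    by (fastforce simp: totatives_def unit_residues_def)
qed

lemma card_unit_residues:
  assumes "n > 0"
  shows "card (unit_residues n) = totient n"
proof (cases "n = 1")
  case False
  then show ?thesis
    using assms by (simp add: totient_def totatives_eq_unit_residues)
qed simp

text \<open>For \<open>d dvd n\<close> this is the surjectivity of reduction on units. The witness
  is \<open>x + d * k\<close>, where \<open>k\<close> collects the primes of \<open>n\<close> that
  do not divide \<open>x\<close>.\<close>

lemma exists_coprime_cong:
  fixes x d n :: nat
  assumes "n > 0" "coprime x d"
  shows "\<exists>a. coprime a n \<and> [a = x] (mod d)"
proof (intro exI conjI)
  define k where "k = \<Prod>{p \<in> prime_factors n. \<not> p dvd x}"
  have dvd_k: "p dvd k \<longleftrightarrow> \<not> p dvd x" if "prime p" "p dvd n" for p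
  proof -
    have "p dvd k \<longleftrightarrow> (\<exists>q\<in>{q \<in> prime_factors n. \<not> q dvd x}. p dvd q)"
      unfolding k_def using that by (subst prime_dvd_prod_iff) auto
    also have "\<dots> \<longleftrightarrow> \<not> p dvd x"
      using that assms by (auto simp: in_prime_factors_iff dest: primes_dvd_imp_eq)
    finally show ?thesis .
  qed
  \<comment> \<open>Every prime of \<open>n\<close> divides exactly one of \<open>x\<close> and
    \<open>d * k\<close>: one dividing \<open>x\<close> divides neither \<open>k\<close> nor, by
    coprimality, \<open>d\<close>; any other divides \<open>k\<close>.\<close>
  show "coprime (x + d * k) n"
  proof (rule ccontr)
    assume "\<not> coprime (x + d * k) n"
    then obtain p where p: "prime p" "p dvd x + d * k" "p dvd n"
      by (metis coprime_iff_gcd_eq_1 gcd_greatest_iff prime_factor_nat)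
    show False
    proof (cases "p dvd x")
      case True
      then have "p dvd d"
        using p dvd_k[of p] by (simp add: dvd_add_right_iff prime_dvd_mult_iff)
      then show False
        using True p assms by (meson coprime_common_divisor not_prime_unit)
    next
      case False
      then show False
        using p dvd_k[of p] by (metis dvd_add_left_iff dvd_mult)
    qed
  qed
  show "[x + d * k = x] (mod d)"
    by (simp add: cong_def)
qed

text \<open>Multiplication by a unit \<open>u\<close> modulo \<open>n\<close> with \<open>u\<close>
  congruent to \<open>y / x\<close> modulo \<open>d\<close> maps the fibre over \<open>x\<close>
  injectively into the fibre over \<open>y\<close>. Exchanging \<open>x\<close> and \<open>y\<close>
  later turns the inequality into an equality.\<close>

lemma card_unit_residues_cong_le:
  assumes "n > 0" "d dvd n" "coprime x d" "coprime y d"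
  shows "card {a \<in> unit_residues n. [a = x] (mod d)} \<le> card {a \<in> unit_residues n. [a = y] (mod d)}"
proof -
  obtain v where v: "[x * v = 1] (mod d)"
    using assms cong_solve_coprime_nat by auto
  then have "coprime v d"
    by (metis cong_imp_coprime cong_sym coprime_1_left coprime_mult_left_iff)
  \<comment> \<open>The quotient \<open>v * y\<close> is a unit only modulo \<open>d\<close>; it is
    lifted so that multiplication by it can be cancelled modulo \<open>n\<close>.\<close>
  then obtain u where u: "coprime u n" "[u = v * y] (mod d)"
    using exists_coprime_cong[of n "v * y" d] assms by auto
  have "[u * x = y] (mod d)"
  proof -
    have "[u * x = v * y * x] (mod d)"
      using u(2) by (rule cong_scalar_right)
    also have "v * y * x = x * v * y"
      by (simp add: mult_ac)
    also have "[x * v * y = 1 * y] (mod d)"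
      using v by (rule cong_scalar_right)
    finally show ?thesis by simp
  qed
  then have *: "[u * a mod n = y] (mod d)" if "[a = x] (mod d)" for a
    using that assms(2) by (metis cong_def cong_scalar_left mod_mod_cancel)
  show ?thesis
  proof (rule card_inj_on_le)
    show "inj_on (\<lambda>a. u * a mod n) {a \<in> unit_residues n. [a = x] (mod d)}"
      using u(1) by (auto intro!: inj_onI simp: unit_residues_def simp flip: cong_def
          simp: cong_mult_lcancel_nat dest: cong_less_modulus_unique_nat)
    show "(\<lambda>a. u * a mod n) ` {a \<in> unit_residues n. [a = x] (mod d)} \<subseteq>
          {a \<in> unit_residues n. [a = y] (mod d)}"
      using u(1) * assms(1) by (auto simp: unit_residues_def)
  qed simp
qed

lemma mod_in_unit_residues:
  assumes "n > 0" "d dvd n" "a \<in> unit_residues n"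
  shows "a mod d \<in> unit_residues d"
proof -
  have "d > 0"
    using assms by (auto intro: dvd_pos_nat)
  moreover have "coprime a d"
    using assms by (auto simp: unit_residues_def intro: coprime_divisors)
  ultimately show ?thesis
    by (simp add: unit_residues_def)
qed

text \<open>All fibres of reduction modulo \<open>d\<close> have the same size. Counting over
  \<open>X\<close> and over all units modulo \<open>d\<close> and eliminating that size gives the
  identity.\<close>

lemma card_unit_residues_mod_in:
  assumes "n > 0" "d dvd n" "X \<subseteq> unit_residues d"
  shows "totient d * card {a \<in> unit_residues n. a mod d \<in> X} = totient n * card X"
proof -
  define F where "F x = {a \<in> unit_residues n. a mod d = x}" for x
  have F: "F x = {a \<in> unit_residues n. [a = x] (mod d)}" if "x \<in> unit_residues d" for x
    using that by (auto simp: F_def cong_def unit_residues_def)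
  have "d > 0"
    using assms by (auto intro: dvd_pos_nat)
  \<comment> \<open>The reference fibre is over \<open>1 mod d\<close> because the identity class is
    represented by 0 when \<open>d = 1\<close>.\<close>
  have const: "card (F x) = card (F (1 mod d))" if "x \<in> unit_residues d" for x
  proof -
    have "1 mod d \<in> unit_residues d"
      using \<open>d > 0\<close> by (simp add: unit_residues_def)
    with that show ?thesis
      using card_unit_residues_cong_le[OF assms(1,2)]
      by (auto simp: F intro!: antisym) (auto simp: unit_residues_def)
  qed
  have card: "card {a \<in> unit_residues n. a mod d \<in> Y} = card Y * card (F (1 mod d))"
    if "Y \<subseteq> unit_residues d" for Y
  proof -
    have "{a \<in> unit_residues n. a mod d \<in> Y} = (\<Union>x\<in>Y. F x)"
      by (auto simp: F_def)
    also have "card \<dots> = (\<Sum>x\<in>Y. card (F x))"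
      using finite_subset[OF that] by (intro card_UN_disjoint) (auto simp: F_def)
    also have "\<dots> = card Y * card (F (1 mod d))"
      using const that by (simp add: subset_iff)
    finally show ?thesis .
  qed
  have "{a \<in> unit_residues n. a mod d \<in> unit_residues d} = unit_residues n"
    using mod_in_unit_residues[OF assms(1,2)] by auto
  with card[of "unit_residues d"] have "totient n = totient d * card (F (1 mod d))"
    using assms \<open>d > 0\<close> by (simp add: card_unit_residues)
  then show ?thesis
    using card[OF assms(3)] by simp
qed

lemma poly_cong:
  fixes P :: "int poly"
  assumes "[x = y] (mod m)"
  shows "[poly P x = poly P y] (mod m)"
  using assms by (induction P) (auto intro!: cong_add cong_mult)

lemma num_unit_roots_mod_eq_card:
  "num_unit_roots_mod P d = card {x \<in> unit_residues d. int d dvd poly P (int x)}"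
  unfolding num_unit_roots_mod_def
  by (rule bij_betw_same_card[of nat], rule bij_betw_byWitness[where f' = int])
     (auto simp: unit_residues_def cong_0_iff nat_less_iff simp flip: coprime_iff_gcd_eq_1
        coprime_int_iff)

text \<open>Whether \<open>d\<close> divides \<open>P(a)\<close> depends only on
  \<open>a mod d\<close>, so the set on the left is the preimage of the unit roots modulo
  \<open>d\<close>.\<close>

lemma card_unit_residues_dvd_poly:
  assumes "n > 0" "d dvd n"
  shows "totient d * card {a \<in> unit_residues n. int d dvd poly P (int a)} =
         totient n * num_unit_roots_mod P d"
proof -
  have "int d dvd poly P (int a) \<longleftrightarrow> int d dvd poly P (int (a mod d))" for a
    using poly_cong[of "int a" "int (a mod d)" "int d" P]
    by (intro cong_dvd_iff) (auto simp: zmod_int)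
  then have "{a \<in> unit_residues n. int d dvd poly P (int a)} =
             {a \<in> unit_residues n. a mod d \<in> {x \<in> unit_residues d. int d dvd poly P (int x)}}"
    using mod_in_unit_residues[OF assms] by blast
  then show ?thesis
    using card_unit_residues_mod_in[OF assms, of "{x \<in> unit_residues d. int d dvd poly P (int x)}"]
    by (simp add: num_unit_roots_mod_eq_card)
qed

theorem theorem7:
  fixes f :: "nat \<Rightarrow> complex" and P :: "int poly" and n :: nat
  assumes "n \<ge> 1"
  shows "(\<Sum>a | a \<in> {1..n} \<and> gcd a n = 1. f (nat (gcd (poly P (int a)) (int n)))) =
         of_nat (totient n) *
           (\<Sum>d | d dvd n. dirichlet_conv moebius_mu f d / of_nat (totient d)
                            * of_nat (num_unit_roots_mod P d))"
proof -
  let ?g = "dirichlet_conv moebius_mu f" and ?G = "\<lambda>a. nat (gcd (poly P (int a)) (int n))"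
  have n: "n > 0" and fin: "finite {d. d dvd n}"
    using assms by auto
  have "{a. a \<in> {1..n} \<and> gcd a n = 1} = totatives n"
    by (auto simp: totatives_def simp: coprime_iff_gcd_eq_1 simp del: coprime_imp_gcd_eq_1)
  \<comment> \<open>For \<open>n = 1\<close> the index sets are {1} and {0}, but both sums equal
    \<open>f 1\<close>.\<close>
  then have "(\<Sum>a | a \<in> {1..n} \<and> gcd a n = 1. f (?G a)) = (\<Sum>a\<in>unit_residues n. f (?G a))"
    using assms by (cases "n = 1") (simp_all add: totatives_eq_unit_residues)
  also have "\<dots> = (\<Sum>a\<in>unit_residues n. \<Sum>d | d dvd n \<and> int d dvd poly P (int a). ?g d)"
  proof (rule sum.cong)
    fix a
    have "d dvd ?G a \<longleftrightarrow> d dvd n \<and> int d dvd poly P (int a)" for d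
      by (auto simp: nat_dvd_iff simp flip: int_dvd_int_iff)
    \<comment> \<open>Inversion needs a positive argument; \<open>n > 0\<close> ensures this even
      when \<open>P(a) = 0\<close>.\<close>
    moreover have "?G a > 0"
      using n by simp
    ultimately show "f (?G a) = (\<Sum>d | d dvd n \<and> int d dvd poly P (int a). ?g d)"
      using moebius_inversion[of "?G a" f] by simp
  qed simp
  also have "\<dots> = (\<Sum>d | d dvd n. \<Sum>a | a \<in> unit_residues n \<and> int d dvd poly P (int a). ?g d)"
    using sum.swap_restrict[OF finite_unit_residues fin, of "\<lambda>_ d. ?g d" "\<lambda>a d. int d dvd poly P (int a)"]
    by simp
  also have "\<dots> = (\<Sum>d | d dvd n. of_nat (totient n) *
                     (?g d / of_nat (totient d) * of_nat (num_unit_roots_mod P d)))"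
  proof (rule sum.cong)
    fix d assume "d \<in> {d. d dvd n}"
    then have d: "d dvd n" and "totient d \<noteq> 0"
      using n by (auto simp: dvd_pos_nat)
    \<comment> \<open>The summand is constant in \<open>a\<close>, so only the count matters; its
      identity is divided by the nonzero \<open>totient d\<close> in the complex numbers.\<close>
    then show "(\<Sum>a | a \<in> unit_residues n \<and> int d dvd poly P (int a). ?g d) =
               of_nat (totient n) * (?g d / of_nat (totient d) * of_nat (num_unit_roots_mod P d))"
      using arg_cong[OF card_unit_residues_dvd_poly[OF n d, of P], of "of_nat :: nat \<Rightarrow> complex"]
      by (simp add: field_simps)
  qed simp
  finally show ?thesis
    by (simp add: sum_distrib_left)
qed

end
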